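(* Let $R=\mathbb{Z}_2$ and let $M$ be a finite $R$-module. Then $C_{\mathbf 1,\mathbf 1}(M)=2C(M)$, $D_{\mathbf 1,\mathbf 1}(M)=D(M)+1$, and $E_{\mathbf 1,\mathbf 1}(M)=E(M)$.
   Context: $\mathbb{Z}_2=\mathbb{Z}/2\mathbb{Z}$. A sequence of length $k$ in $M$ is an element of $M^k$. A subsequence is obtained by selecting terms at some positions and is always nonempty. In a subsequence of consecutive terms, the selected positions are consecutive. A sequence $(x_1,\ldots,x_k)$ in $M$ is a zero-sum sequence if $x_1+\cdots+x_k=0$ in $M$. It is a $(\mathbf 1,\mathbf 1)$-weighted zero-sum sequence (where $\mathbf 1=\{1\}\subseteq\mathbb{Z}_2$) if $x_1+\cdots+x_k=0$ in $M$ and the sum of $k$ copies of $1$ is $0$ in $\mathbb{Z}_2$. $D(M)$ (resp. $D_{\mathbf 1,\mathbf 1}(M)$) is the least positive integer $k$ such that every sequence of length $k$ in $M$ has a zero-sum (resp. $(\mathbf 1,\mathbf 1)$-weighted zero-sum) subsequence. $C(M)$ (resp. $C_{\mathbf 1,\mathbf 1}(M)$) is the least positive integer $k$ such that every sequence of length $k$ in $M$ has a zero-sum (resp. $(\mathbf 1,\mathbf 1)$-weighted zero-sum) subsequence of consecutive terms. $E(M)$ (resp. $E_{\mathbf 1,\mathbf 1}(M)$) is the least positive integer $k$ such that every sequence of length $k$ in $M$ has a zero-sum (resp. $(\mathbf 1,\mathbf 1)$-weighted zero-sum) subsequence of length $|M|$, where $|M|$ is the number of elements of $M$.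
   Formalization: The equation E_{1,1}(M)=E(M) is stated only for M nonzero: for M=0 one has |M|=1 and no sequence of length 1 is (1,1)-weighted zero-sum, so E_{1,1}(0) does not exist; the C and D equations cover every finite M. *)

theory Defs
  imports Complex_Main "HOL-Library.Z2" "HOL-Library.Sublist" "HOL-Library.Cardinality"
begin

text \<open>
  A module \<open>M\<close> is represented by a type \<open>'m\<close> of class \<open>ab_group_add\<close>, with a scalar
  multiplication satisfying the locale \<open>Modules.module\<close>; \<open>|M|\<close> is \<open>CARD('m)\<close>. The ring
  \<open>\<int>/2\<int>\<close> is the type \<open>bit\<close>. Sequences in \<open>M\<close> are lists; \<open>subseq\<close> is subsequence,
  \<open>sublist\<close> is subsequence of consecutive terms. Both allow the empty list, which
  is excluded explicitly below.
\<close>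

definition zero_sum :: "'m::ab_group_add list \<Rightarrow> bool" where
  "zero_sum xs \<longleftrightarrow> sum_list xs = 0"

definition one_one_zero_sum :: "'m::ab_group_add list \<Rightarrow> bool" where
  "one_one_zero_sum xs \<longleftrightarrow> sum_list xs = 0 \<and> (\<Sum>x\<leftarrow>xs. (1::bit)) = 0"

text \<open>
  The constants are parameterized by the predicate \<open>Z\<close> required of the subsequence:
  \<open>Z = zero_sum\<close> gives \<open>C(M), D(M), E(M)\<close>, and \<open>Z = one_one_zero_sum\<close> gives the
  \<open>(1,1)\<close>-weighted versions.
\<close>

definition C_const :: "('m list \<Rightarrow> bool) \<Rightarrow> nat" where
  "C_const Z = (LEAST k. 0 < k \<and>
     (\<forall>xs. length xs = k \<longrightarrow> (\<exists>ys. ys \<noteq> [] \<and> sublist ys xs \<and> Z ys)))"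

definition D_const :: "('m list \<Rightarrow> bool) \<Rightarrow> nat" where
  "D_const Z = (LEAST k. 0 < k \<and>
     (\<forall>xs. length xs = k \<longrightarrow> (\<exists>ys. ys \<noteq> [] \<and> subseq ys xs \<and> Z ys)))"

definition E_const :: "('m list \<Rightarrow> bool) \<Rightarrow> nat" where
  "E_const Z = (LEAST k. 0 < k \<and>
     (\<forall>xs. length xs = k \<longrightarrow>
       (\<exists>ys. ys \<noteq> [] \<and> subseq ys xs \<and> length ys = CARD('m) \<and> Z ys)))"

text \<open>
  If \<open>M\<close> is trivial then \<open>|M| = 1\<close>, and no sequence of length \<open>1\<close> is
  \<open>(1,1)\<close>-weighted zero-sum, because \<open>1 \<noteq> 0\<close> in \<open>\<int>/2\<int>\<close>. So the set of \<open>k\<close> in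
  \<open>E_const one_one_zero_sum\<close> is empty and the \<open>LEAST\<close> is unspecified.
\<close>

end

theory Submission
  imports Defs
begin

text \<open>
  The weight condition over \<open>\<int>/2\<int>\<close> says that the length is even, so a
  \<open>(1,1)\<close>-weighted zero-sum sequence is a zero-sum sequence of even length
  (\<open>one_one_zero_sum_iff\<close>).

  A block of consecutive terms has sum zero iff the prefix sums at its two ends agree, and it has
  even length iff the two end positions have the same parity. So a sequence of length \<open>n\<close> avoids
  zero-sum blocks iff its \<open>n + 1\<close> prefix sums are distinct elements of \<open>M\<close>, and avoids even
  zero-sum blocks iff the \<open>n + 1\<close> pairs of a prefix sum and its parity are distinct. The largest
  possible number of distinct values is \<open>|M|\<close> in the first case and \<open>2|M|\<close> in the second, and
  both are attained, since a sequence can be given any prefix sums up to a common translation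
  (\<open>sum_list_take_differences\<close>). Hence \<open>C(M) = |M|\<close> and the weighted constant is \<open>2|M|\<close>.

  The other two equations use that \<open>x + x = 0\<close> in \<open>M\<close>. For \<open>D\<close>, translate all terms of a sequence
  but the first term \<open>x\<close> by \<open>x\<close>. A zero-sum subsequence of the translates gives a subsequence of
  the original terms whose sum is \<open>0\<close> if its length is even and \<open>x\<close> if its length is odd; in the
  second case adding the term \<open>x\<close> itself repairs both the sum and the parity
  (\<open>unavoidable_one_one_zero_sum_Suc\<close>). Conversely, putting a term \<open>0\<close> in front of a sequence
  without zero-sum subsequences creates only the zero-sum subsequence \<open>(0)\<close>, which is odd
  (\<open>unavoidable_zero_sum_if_Suc\<close>). For \<open>E\<close>, if \<open>M\<close> is nontrivial then \<open>|M|\<close> is even, so the parity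
  condition holds for every subsequence of length \<open>|M|\<close>.
\<close>

section \<open>Thresholds for unavoidable subsequences\<close>

definition unavoidable :: "('a list \<Rightarrow> 'a list \<Rightarrow> bool) \<Rightarrow> ('a list \<Rightarrow> bool) \<Rightarrow> nat \<Rightarrow> bool" where
  "unavoidable R Z k \<longleftrightarrow> (\<forall>xs. length xs = k \<longrightarrow> (\<exists>ys. ys \<noteq> [] \<and> R ys xs \<and> Z ys))"

lemma C_const_eq_Least: "C_const Z = (LEAST k. 0 < k \<and> unavoidable sublist Z k)"
  by (simp add: C_const_def unavoidable_def)

lemma D_const_eq_Least: "D_const Z = (LEAST k. 0 < k \<and> unavoidable subseq Z k)"
  by (simp add: D_const_def unavoidable_def)

text \<open>
  A longer sequence has an initial segment of the shorter length, so the property is upward closed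
  in the length. The constants are therefore thresholds, and it suffices to find two consecutive
  lengths between which the property starts to hold.
\<close>

lemma unavoidable_mono:
  assumes R: "\<And>ys xs i. R ys (take i xs) \<Longrightarrow> R ys xs"
    and j: "unavoidable R Z j" and "j \<le> k"
  shows "unavoidable R Z k"
  unfolding unavoidable_def
proof (intro allI impI)
  fix xs :: "'a list"
  assume "length xs = k"
  then have "length (take j xs) = j"
    using \<open>j \<le> k\<close> by simp
  then obtain ys where "ys \<noteq> []" "R ys (take j xs)" "Z ys"
    using j unfolding unavoidable_def by blast
  then show "\<exists>ys. ys \<noteq> [] \<and> R ys xs \<and> Z ys"
    using R by blast
qed

lemma Least_unavoidable_eqI:
  assumes R: "\<And>ys xs i. R ys (take i xs) \<Longrightarrow> R ys xs"
    and "unavoidable R Z (Suc m)" and not_m: "\<not> unavoidable R Z m"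
  shows "(LEAST k. 0 < k \<and> unavoidable R Z k) = Suc m"
proof (rule Least_equality)
  fix k
  assume k: "0 < k \<and> unavoidable R Z k"
  have "\<not> k \<le> m"
    using unavoidable_mono[of R Z k m] R k not_m by blast
  then show "Suc m \<le> k"
    by simp
qed (use assms in auto)

lemma sublist_of_take: "sublist ys (take i xs) \<Longrightarrow> sublist ys xs"
  by (meson sublist_order.order.trans sublist_take)

lemma subseq_of_take: "subseq ys (take i xs) \<Longrightarrow> subseq ys xs"
  using sublist_imp_subseq[OF sublist_take] subseq_order.trans by blast

section \<open>Blocks of consecutive terms and prefix sums\<close>

lemma one_one_zero_sum_iff: "one_one_zero_sum xs \<longleftrightarrow> zero_sum xs \<and> even (length xs)"
proof -
  have "(\<Sum>x\<leftarrow>xs. (1::bit)) = of_bool (odd (length xs))"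
    by (induction xs) auto
  then show ?thesis
    by (auto simp: one_one_zero_sum_def zero_sum_def)
qed

lemma nonempty_sublist_iff:
  "ys \<noteq> [] \<and> sublist ys xs \<longleftrightarrow> (\<exists>i j. i < j \<and> j \<le> length xs \<and> ys = drop i (take j xs))"
proof
  assume "ys \<noteq> [] \<and> sublist ys xs"
  then obtain us vs where "xs = us @ ys @ vs" "ys \<noteq> []"
    by (auto simp: sublist_def)
  then show "\<exists>i j. i < j \<and> j \<le> length xs \<and> ys = drop i (take j xs)"
    by (intro exI[of _ "length us"] exI[of _ "length us + length ys"]) auto
next
  assume "\<exists>i j. i < j \<and> j \<le> length xs \<and> ys = drop i (take j xs)"
  then show "ys \<noteq> [] \<and> sublist ys xs"
    by (auto intro: sublist_of_take)
qed

lemma zero_sum_drop_take_iff: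
  fixes xs :: "'m::ab_group_add list"
  assumes "i \<le> j"
  shows "zero_sum (drop i (take j xs)) \<longleftrightarrow> sum_list (take i xs) = sum_list (take j xs)"
proof -
  have "take i xs @ drop i (take j xs) = take j xs"
    using assms by (metis append_take_drop_id min.absorb1 take_take)
  then have "sum_list (take j xs) = sum_list (take i xs) + sum_list (drop i (take j xs))"
    by (metis sum_list_append)
  then show ?thesis
    by (simp add: zero_sum_def)
qed

lemma inj_on_atMost_iff:
  fixes p :: "nat \<Rightarrow> 'a"
  shows "inj_on p {..n} \<longleftrightarrow> (\<forall>i j. i < j \<and> j \<le> n \<longrightarrow> p i \<noteq> p j)"
  proof
  assume inj: "inj_on p {..n}"
  show "\<forall>i j. i < j \<and> j \<le> n \<longrightarrow> p i \<noteq> p j"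
  proof (intro allI impI)
    fix i j
    assume "i < j \<and> j \<le> n"
    then show "p i \<noteq> p j"
      using inj_onD[OF inj, of i j] by auto
  qed
next
  assume "\<forall>i j. i < j \<and> j \<le> n \<longrightarrow> p i \<noteq> p j"
  then show "inj_on p {..n}"
    by (intro linorder_inj_onI') auto
qed

text \<open>
  Blocks correspond to pairs of positions \<open>i < j\<close>, and zero-sum blocks to coincidences between
  prefix sums. This turns the computation of \<open>C\<close> into a question about injectivity.
\<close>

lemma ex_zero_sum_sublist_iff:
  fixes xs :: "'m::ab_group_add list"
  shows "(\<exists>ys. ys \<noteq> [] \<and> sublist ys xs \<and> zero_sum ys) \<longleftrightarrow>
    \<not> inj_on (\<lambda>i. sum_list (take i xs)) {..length xs}"
proof -
  have "(\<exists>ys. ys \<noteq> [] \<and> sublist ys xs \<and> zero_sum ys) \<longleftrightarrow>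
      (\<exists>i j. i < j \<and> j \<le> length xs \<and> zero_sum (drop i (take j xs)))"
    unfolding conj_assoc[symmetric] nonempty_sublist_iff by blast
  then show ?thesis
    unfolding inj_on_atMost_iff using zero_sum_drop_take_iff[OF less_imp_le] by blast
qed

text \<open>
  The block between positions \<open>i\<close> and \<open>j\<close> has length \<open>j - i\<close>, which is even iff \<open>i\<close> and \<open>j\<close> have
  the same parity. Recording that parity next to the prefix sum amounts to working in
  \<open>M \<times> \<int>/2\<int>\<close>.
\<close>

lemma ex_one_one_zero_sum_sublist_iff:
  fixes xs :: "'m::ab_group_add list"
  shows "(\<exists>ys. ys \<noteq> [] \<and> sublist ys xs \<and> one_one_zero_sum ys) \<longleftrightarrow>
    \<not> inj_on (\<lambda>i. (sum_list (take i xs), even i)) {..length xs}"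
proof -
  have *: "one_one_zero_sum (drop i (take j xs)) \<longleftrightarrow>
      (sum_list (take i xs), even i) = (sum_list (take j xs), even j)"
    if "i < j" "j \<le> length xs" for i j
    using that by (auto simp: one_one_zero_sum_iff zero_sum_drop_take_iff)
  have "(\<exists>ys. ys \<noteq> [] \<and> sublist ys xs \<and> one_one_zero_sum ys) \<longleftrightarrow>
      (\<exists>i j. i < j \<and> j \<le> length xs \<and> one_one_zero_sum (drop i (take j xs)))"
    unfolding conj_assoc[symmetric] nonempty_sublist_iff by blast
  then show ?thesis
    unfolding inj_on_atMost_iff using * by blast
qed

lemma not_inj_on_atMost_CARD:
  fixes p :: "nat \<Rightarrow> 'a::finite"
  shows "\<not> inj_on p {..CARD('a)}"
proof
  assume "inj_on p {..CARD('a)}"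
  then have "card {..CARD('a)} \<le> CARD('a)"
    by (rule card_inj_on_le) auto
  then show False
    by simp
qed

text \<open>
  Sequences without zero-sum blocks are constructed from their prefix sums: the differences of any
  \<open>s\<close> telescope back to \<open>s\<close>, up to the translation by \<open>s 0\<close>, which does not affect injectivity.
\<close>

lemma sum_list_take_differences:
  fixes s :: "nat \<Rightarrow> 'm::ab_group_add"
  assumes "i \<le> n"
  shows "sum_list (take i (map (\<lambda>i. s (Suc i) - s i) [0..<n])) = s i - s 0"
proof -
  have "sum_list (map (\<lambda>i. s (Suc i) - s i) [0..<i]) = s i - s 0"
    by (induction i) (auto simp: algebra_simps)
  then show ?thesis
    using assms by (simp add: take_map take_upt)
qed

lemma ex_enumeration: "\<exists>s :: nat \<Rightarrow> 'a::finite. inj_on s {..<CARD('a)}"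
  using ex_bij_betw_nat_finite[of "UNIV :: 'a set"]
  by (auto simp: bij_betw_def atLeast0LessThan)

text \<open>
  The upper bound is the pigeonhole principle for the prefix sums. The differences of an enumeration
  of \<open>M\<close> have pairwise distinct prefix sums and so show that \<open>|M| - 1\<close> terms do not suffice.
\<close>

lemma C_const_zero_sum:
  "C_const (zero_sum :: 'm::{ab_group_add, finite} list \<Rightarrow> bool) = CARD('m)"
proof -
  obtain s :: "nat \<Rightarrow> 'm" where s: "inj_on s {..<CARD('m)}"
    using ex_enumeration by blast
  define n where "n = CARD('m) - 1"
  have n: "CARD('m) = Suc n"
    by (simp add: n_def)
  define xs where "xs = map (\<lambda>i. s (Suc i) - s i) [0..<n]"
  have "inj_on (\<lambda>i. sum_list (take i xs)) {..n}"
    using s by (auto simp: inj_on_def xs_def sum_list_take_differences n)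
  moreover have len: "length xs = n"
    by (simp add: xs_def)
  ultimately have "\<not> unavoidable sublist (zero_sum :: 'm list \<Rightarrow> bool) n"
    unfolding unavoidable_def ex_zero_sum_sublist_iff by blast
  moreover have "unavoidable sublist (zero_sum :: 'm list \<Rightarrow> bool) (Suc n)"
    using not_inj_on_atMost_CARD[where 'a = 'm]
    unfolding unavoidable_def ex_zero_sum_sublist_iff n by simp
  ultimately show ?thesis
    unfolding C_const_eq_Least n
    by (intro Least_unavoidable_eqI) (rule sublist_of_take)
qed

text \<open>
  Pairs of a prefix sum and a parity take at most \<open>2|M|\<close> values. All of them are attained by a
  sequence whose prefix sums run through an enumeration of \<open>M\<close> and take each value twice in a row,
  once at an even and once at an odd position.
\<close>

lemma C_const_one_one_zero_sum:
  "C_const (one_one_zero_sum :: 'm::{ab_group_add, finite} list \<Rightarrow> bool) = 2 * CARD('m)"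
proof -
  obtain s :: "nat \<Rightarrow> 'm" where s: "inj_on s {..<CARD('m)}"
    using ex_enumeration by blast
  define n where "n = 2 * CARD('m) - 1"
  have "0 < CARD('m)"
    by simp
  then have n: "2 * CARD('m) = Suc n"
    unfolding n_def by linarith
  \<comment> \<open>The prefix sums \<open>s 0, s 0, s 1, s 1, \<dots>\<close>: the value and the parity of \<open>i\<close> together determine \<open>i\<close>.\<close>
  define t where "t i = s (i div 2)" for i
  define xs where "xs = map (\<lambda>i. t (Suc i) - t i) [0..<n]"
  have "inj_on (\<lambda>i. (sum_list (take i xs), even i)) {..n}"
  proof (rule inj_onI)
    fix i j
    assume ij: "i \<in> {..n}" "j \<in> {..n}"
      and eq: "(sum_list (take i xs), even i) = (sum_list (take j xs), even j)"
    have "s (i div 2) = s (j div 2)"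
      using ij eq sum_list_take_differences[of _ n t] by (simp add: xs_def flip: t_def)
    moreover have "i div 2 < CARD('m)" "j div 2 < CARD('m)"
      using ij n by auto
    ultimately have "i div 2 = j div 2"
      using s by (auto simp: inj_on_def)
    then show "i = j"
      using eq bit_eq_rec[of i j] by simp
  qed
  moreover have "length xs = n"
    by (simp add: xs_def)
  ultimately have "\<not> unavoidable sublist (one_one_zero_sum :: 'm list \<Rightarrow> bool) n"
    unfolding unavoidable_def ex_one_one_zero_sum_sublist_iff by blast
  moreover have "unavoidable sublist (one_one_zero_sum :: 'm list \<Rightarrow> bool) (Suc n)"
  proof -
    have "CARD('m \<times> bool) = Suc n"
      using n by simp
    then show ?thesis
      using not_inj_on_atMost_CARD[where 'a = "'m \<times> bool"]
      unfolding unavoidable_def ex_one_one_zero_sum_sublist_iff by simp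
  qed
  ultimately show ?thesis
    unfolding C_const_eq_Least n
    by (intro Least_unavoidable_eqI) (rule sublist_of_take)
qed

section \<open>Subsequences of arbitrary terms\<close>

text \<open>
  The set of lengths in the definition of \<open>D\<close> is nonempty because a block of consecutive terms is
  in particular a subsequence, and every sequence of length \<open>|M|\<close> has a zero-sum block.
\<close>

lemma D_const_zero_sum:
  obtains m where "D_const (zero_sum :: 'm::{ab_group_add, finite} list \<Rightarrow> bool) = Suc m"
    and "unavoidable subseq (zero_sum :: 'm list \<Rightarrow> bool) (Suc m)"
    and "\<not> unavoidable subseq (zero_sum :: 'm list \<Rightarrow> bool) m"
proof -
  let ?P = "unavoidable subseq (zero_sum :: 'm list \<Rightarrow> bool)"
  have "?P (CARD('m))"
    unfolding unavoidable_def
  proof (intro allI impI)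
    fix xs :: "'m list"
    assume "length xs = CARD('m)"
    then have "\<exists>ys. ys \<noteq> [] \<and> sublist ys xs \<and> zero_sum ys"
      unfolding ex_zero_sum_sublist_iff by (simp add: not_inj_on_atMost_CARD)
    then show "\<exists>ys. ys \<noteq> [] \<and> subseq ys xs \<and> zero_sum ys"
      using sublist_imp_subseq by blast
  qed
  moreover have "\<not> ?P 0"
    by (simp add: unavoidable_def)
  ultimately obtain m where "\<not> ?P m" "?P (Suc m)"
    using ex_least_nat_less[of ?P "CARD('m)"] by blast
  then have "D_const (zero_sum :: 'm list \<Rightarrow> bool) = Suc m"
    unfolding D_const_eq_Least by (intro Least_unavoidable_eqI) (rule subseq_of_take)
  then show ?thesis
    using that \<open>\<not> ?P m\<close> \<open>?P (Suc m)\<close> by blast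
qed

text \<open>
  The first term \<open>x\<close> is kept in reserve and the others are translated by it. A zero-sum choice \<open>ws\<close>
  among the translates satisfies \<open>sum_list ws + |ws| x = 0\<close>. As \<open>x + x = 0\<close>, this is
  \<open>sum_list ws = 0\<close> when \<open>ws\<close> has even length; when it has odd length, it says that \<open>x # ws\<close>, of even
  length, has sum zero.
\<close>

lemma unavoidable_one_one_zero_sum_Suc:
  assumes two: "\<And>x :: 'm::ab_group_add. x + x = 0"
    and "unavoidable subseq (zero_sum :: 'm list \<Rightarrow> bool) k"
  shows "unavoidable subseq (one_one_zero_sum :: 'm list \<Rightarrow> bool) (Suc k)"
  unfolding unavoidable_def
proof (intro allI impI)
  fix xs :: "'m list"
  assume "length xs = Suc k"
  then obtain x zs where xs: "xs = x # zs" "length zs = k"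
    by (auto simp: length_Suc_conv)
  moreover have "length (map (\<lambda>z. z + x) zs) = k"
    using xs by simp
  ultimately obtain ys where "ys \<noteq> []" "subseq ys (map (\<lambda>z. z + x) zs)" "zero_sum ys"
    using assms(2) unfolding unavoidable_def by blast
  then obtain N where "ys = map (\<lambda>z. z + x) (nths zs N)"
    by (auto simp: subseq_conv_nths nths_map)
  moreover define ws where "ws = nths zs N"
  ultimately have ys: "ys = map (\<lambda>z. z + x) ws"
    by simp
  have "ws \<noteq> []"
    using \<open>ys \<noteq> []\<close> ys by simp
  have "subseq ws zs"
    by (auto simp: ws_def subseq_conv_nths)
  have "sum_list (map (\<lambda>z. z + x) vs) = sum_list vs + (if even (length vs) then 0 else x)" for vs
    by (induction vs) (auto simp: algebra_simps two)
  then have sum: "sum_list ws + (if even (length ws) then 0 else x) = 0"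
    using \<open>zero_sum ys\<close> by (simp add: ys zero_sum_def)
  show "\<exists>ys. ys \<noteq> [] \<and> subseq ys xs \<and> one_one_zero_sum ys"
  proof (cases "even (length ws)")
    case True
    then have "one_one_zero_sum ws"
      using sum by (simp add: one_one_zero_sum_iff zero_sum_def)
    moreover have "subseq ws xs"
      using \<open>subseq ws zs\<close> by (simp add: xs list_emb_Cons)
    ultimately show ?thesis
      using \<open>ws \<noteq> []\<close> by blast
  next
    case False
    then have "one_one_zero_sum (x # ws)"
      using sum by (simp add: one_one_zero_sum_iff zero_sum_def add.commute)
    moreover have "subseq (x # ws) xs"
      using \<open>subseq ws zs\<close> by (simp add: xs)
    ultimately show ?thesis
      by blast
  qed
qed

text \<open>
  A term \<open>0\<close> is put in front. An even zero-sum subsequence of the extended sequence has at least two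
  terms, so it remains nonempty when the new term is removed from it, and removing \<open>0\<close> does not
  change the sum.
\<close>

lemma unavoidable_zero_sum_if_Suc:
  assumes "unavoidable subseq (one_one_zero_sum :: 'm::ab_group_add list \<Rightarrow> bool) (Suc k)"
  shows "unavoidable subseq (zero_sum :: 'm list \<Rightarrow> bool) k"
  unfolding unavoidable_def
proof (intro allI impI)
  fix xs :: "'m list"
  assume "length xs = k"
  then have "length (0 # xs) = Suc k"
    by simp
  then obtain ys where "ys \<noteq> []" and sub: "subseq ys (0 # xs)" and ys: "zero_sum ys" "even (length ys)"
    using assms unfolding unavoidable_def one_one_zero_sum_iff by blast
  then obtain y zs where yzs: "ys = y # zs"
    by (cases ys) auto
  then have "zs \<noteq> []"
    using ys by auto
  show "\<exists>ys. ys \<noteq> [] \<and> subseq ys xs \<and> zero_sum ys"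
  proof (cases "y = 0")
    case True
    then have "zero_sum zs" "subseq zs xs"
      using sub ys by (auto simp: yzs zero_sum_def)
    then show ?thesis
      using \<open>zs \<noteq> []\<close> by blast
  next
    case False
    then have "subseq ys xs"
      using sub by (simp add: yzs)
    then show ?thesis
      using \<open>ys \<noteq> []\<close> ys by blast
  qed
qed

lemma D_const_one_one_zero_sum:
  assumes "\<And>x :: 'm::{ab_group_add, finite}. x + x = 0"
  shows "D_const (one_one_zero_sum :: 'm list \<Rightarrow> bool) = D_const (zero_sum :: 'm list \<Rightarrow> bool) + 1"
proof -
  obtain m where m: "D_const (zero_sum :: 'm list \<Rightarrow> bool) = Suc m"
    "unavoidable subseq (zero_sum :: 'm list \<Rightarrow> bool) (Suc m)"
    "\<not> unavoidable subseq (zero_sum :: 'm list \<Rightarrow> bool) m"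
    by (rule D_const_zero_sum)
  have "D_const (one_one_zero_sum :: 'm list \<Rightarrow> bool) = Suc (Suc m)"
    unfolding D_const_eq_Least
    using m unavoidable_zero_sum_if_Suc unavoidable_one_one_zero_sum_Suc[OF assms]
    by (intro Least_unavoidable_eqI) (rule subseq_of_take, assumption, blast+)
  then show ?thesis
    by (simp add: m)
qed

section \<open>Subsequences of length |M|\<close>

text \<open>
  A nonzero \<open>a\<close> acts on \<open>M\<close> by the fixed-point-free involution \<open>x \<mapsto> x + a\<close>, whose orbits
  partition \<open>M\<close> into pairs.
\<close>

lemma even_CARD:
  assumes two: "\<And>x :: 'm::{ab_group_add, finite}. x + x = 0"
    and "CARD('m) \<noteq> 1"
  shows "even (CARD('m))"
proof -
  have "(UNIV :: 'm set) \<noteq> {0}"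
    using \<open>CARD('m) \<noteq> 1\<close> by (metis card_1_singleton_iff One_nat_def)
  then obtain a :: 'm where a: "a \<noteq> 0"
    by auto
  have add_a_twice: "x + a + a = x" for x
    by (simp add: add.assoc two)
  have "2 * card (range (\<lambda>x. {x, x + a})) = card (\<Union>(range (\<lambda>x. {x, x + a})))"
  proof (rule card_partition)
    fix c
    assume "c \<in> range (\<lambda>x. {x, x + a})"
    then show "card c = 2"
      using a by (auto simp: card_insert_if)
  next
    fix c d
    assume "c \<in> range (\<lambda>x. {x, x + a})" "d \<in> range (\<lambda>x. {x, x + a})" "c \<noteq> d"
    then show "c \<inter> d = {}"
      using add_a_twice by auto
  qed auto
  moreover have "\<Union>(range (\<lambda>x. {x, x + a})) = UNIV"
    by auto
  ultimately show ?thesis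
    by (metis dvd_triv_left)
qed

lemma E_const_one_one_zero_sum:
  assumes "\<And>x :: 'm::{ab_group_add, finite}. x + x = 0" and "CARD('m) \<noteq> 1"
  shows "E_const (one_one_zero_sum :: 'm list \<Rightarrow> bool) = E_const (zero_sum :: 'm list \<Rightarrow> bool)"
proof -
  have "length ys = CARD('m) \<and> one_one_zero_sum ys \<longleftrightarrow> length ys = CARD('m) \<and> zero_sum ys"
    for ys :: "'m list"
    using even_CARD[OF assms] by (auto simp: one_one_zero_sum_iff)
  then show ?thesis
    by (simp add: E_const_def)
qed

lemma module_bit_double_eq_0:
  fixes scale :: "bit \<Rightarrow> 'm::ab_group_add \<Rightarrow> 'm"
  assumes "Modules.module scale"
  shows "(x :: 'm) + x = 0"
proof -
  interpret Modules.module scale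
    by fact
  have "x + x = scale (1 + 1) x"
    by (simp only: scale_left_distrib scale_one)
  then show ?thesis
    by simp
qed

section \<open>Comparison of the weighted and unweighted constants\<close>

theorem theorem4p2:
  fixes scale :: "bit \<Rightarrow> 'm::{ab_group_add, finite} \<Rightarrow> 'm"
  assumes "Modules.module scale"
  shows "C_const (one_one_zero_sum :: 'm list \<Rightarrow> bool) = 2 * C_const (zero_sum :: 'm list \<Rightarrow> bool) \<and>
         D_const (one_one_zero_sum :: 'm list \<Rightarrow> bool) = D_const (zero_sum :: 'm list \<Rightarrow> bool) + 1 \<and>
         (CARD('m) \<noteq> 1 \<longrightarrow>
           E_const (one_one_zero_sum :: 'm list \<Rightarrow> bool) = E_const (zero_sum :: 'm list \<Rightarrow> bool))"
  using D_const_one_one_zero_sum[OF module_bit_double_eq_0[OF assms]]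
    E_const_one_one_zero_sum[OF module_bit_double_eq_0[OF assms]]
  by (simp add: C_const_zero_sum C_const_one_one_zero_sum)

end
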